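(* Let $\mathbb{K}$ be an algebraically closed field with $\operatorname{char}(\mathbb{K})\neq 2$ and let $G$ be a connected non-bipartite simple graph on $[n]$. Then the localized $\mathrm{v}$-number of the parity binomial edge ideal $\mathcal{I}_G$ at its minimal prime $\mathfrak{p}^{+}(G)$ equals $\nu_G$: $$\mathrm{v}_{\mathfrak{p}^{+}(G)}(\mathcal{I}_G)=\nu_G .$$
   Context: $[n]=\{1,\dots,n\}$ and $R=\mathbb{K}[x_1,\dots,x_n,y_1,\dots,y_n]$ with the standard grading. The parity binomial edge ideal is $\mathcal{I}_G=(x_ix_j-y_iy_j:\{i,j\}\in E(G))\subseteq R$, and $\mathfrak{p}^{+}(G)=(x_i+y_i: i\in[n])$, which under the given hypotheses is a minimal prime of $\mathcal{I}_G$. For each minimal prime $\mathfrak q\in\min(\mathcal{I}_G)$ put $\mathfrak q(-)=\{i\in[n]: x_i-y_i\in\mathfrak q\}$. Let $\Delta_G=\{\mathfrak q(-):\mathfrak q\in\min(\mathcal{I}_G)\setminus\{\mathfrak p^{+}(G)\}\}$, a collection of (nonempty) subsets of $[n]$. A transversal of $\Delta_G$ is a set $T\subseteq[n]$ with $T\cap e\ne\emptyset$ for all $e\in\Delta_G$, and $\nu_G=\min\{|T|: T\text{ is a transversal of }\Delta_G\}$. For a graded ideal $I\subset R$ and $\mathfrak p\in\mathrm{Ass}(I)$, $\mathrm{v}_{\mathfrak p}(I)=\min\{d\ge 0:\exists f\in R_d \text{ with } I:f=\mathfrak p\}$. *)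

theory Defs
  imports
    "HOL-Library.Poly_Mapping"
    "HOL-Computational_Algebra.Polynomial"
    "HOL-Algebra.Ideal"
    "HOL-Algebra.Algebraic_Closure_Type"
begin

section \<open>Simple graphs\<close>

text \<open>A simple graph is given by its set of edges, each a two-element set of vertices; its
  vertex set is the whole (finite, in the applications below) type \<open>'v\<close>, which plays
  the role of \<open>[n]\<close> with \<open>n = CARD('v)\<close>.\<close>

definition simple_graph :: "'v set set \<Rightarrow> bool" where
  "simple_graph E \<longleftrightarrow> (\<forall>e\<in>E. card e = 2)"

definition connected_graph :: "'v set set \<Rightarrow> bool" where
  "connected_graph E \<longleftrightarrow> (\<forall>u v. (u, v) \<in> {(a, b). {a, b} \<in> E}\<^sup>*)"

definition bipartite_graph :: "'v set set \<Rightarrow> bool" where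
  "bipartite_graph E \<longleftrightarrow> (\<exists>A. \<forall>i j. {i, j} \<in> E \<longrightarrow> (i \<in> A \<longleftrightarrow> j \<notin> A))"

section \<open>Minimal primes and colon ideals\<close>

definition minimal_primes :: "('a, 'b) ring_scheme \<Rightarrow> 'a set \<Rightarrow> 'a set set" where
  "minimal_primes R I =
     {P. primeideal P R \<and> I \<subseteq> P \<and> (\<forall>Q. primeideal Q R \<and> I \<subseteq> Q \<and> Q \<subseteq> P \<longrightarrow> Q = P)}"

definition colon_ideal :: "('a, 'b) ring_scheme \<Rightarrow> 'a set \<Rightarrow> 'a \<Rightarrow> 'a set" where
  "colon_ideal R I f = {g \<in> carrier R. g \<otimes>\<^bsub>R\<^esub> f \<in> I}"

section \<open>The polynomial ring\<close>

text \<open>Polynomials over \<open>'k\<close> in the variables \<open>x\<^sub>i\<close> (index \<open>Inl i\<close>) and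
  \<open>y\<^sub>i\<close> (index \<open>Inr i\<close>), for \<open>i\<close> in \<open>'v\<close>: finitely supported
  functions from monomials (exponent vectors) to coefficients, with convolution product.\<close>

type_synonym ('v, 'k) xy_poly = "('v + 'v \<Rightarrow>\<^sub>0 nat) \<Rightarrow>\<^sub>0 'k"

abbreviation xy_ring :: "('v, 'k::field) xy_poly ring" where
  "xy_ring \<equiv> ring_of_type_algebra"

definition var_x :: "'v \<Rightarrow> ('v, 'k::field) xy_poly" where
  "var_x i = Poly_Mapping.single (Poly_Mapping.single (Inl i) 1) 1"

definition var_y :: "'v \<Rightarrow> ('v, 'k::field) xy_poly" where
  "var_y i = Poly_Mapping.single (Poly_Mapping.single (Inr i) 1) 1"

text \<open>The graded piece \<open>R\<^sub>d\<close> of the standard grading; it contains \<open>0\<close>.\<close>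

definition graded_piece :: "nat \<Rightarrow> ('v, 'k::field) xy_poly set" where
  "graded_piece d =
     {f. \<forall>m \<in> Poly_Mapping.keys f. (\<Sum>v \<in> Poly_Mapping.keys m. Poly_Mapping.lookup m v) = d}"

text \<open>For \<open>P\<close> an associated prime of a graded ideal \<open>I\<close> the set minimized over is nonempty;
  otherwise the value is unspecified.\<close>

definition local_v_number :: "('v, 'k::field) xy_poly set \<Rightarrow> ('v, 'k) xy_poly set \<Rightarrow> nat" where
  "local_v_number P I = (LEAST d. \<exists>f \<in> graded_piece d. colon_ideal xy_ring I f = P)"

section \<open>Parity binomial edge ideals\<close>

definition parity_binomial_edge_ideal :: "'v set set \<Rightarrow> ('v, 'k::field) xy_poly set" where
  "parity_binomial_edge_ideal E =
     genideal xy_ring {var_x i * var_x j - var_y i * var_y j | i j. {i, j} \<in> E}"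

definition p_plus :: "('v, 'k::field) xy_poly set" where
  "p_plus = genideal xy_ring (range (\<lambda>i. var_x i + var_y i))"

definition minus_set :: "('v, 'k::field) xy_poly set \<Rightarrow> 'v set" where
  "minus_set Q = {i. var_x i - var_y i \<in> Q}"

text \<open>The coefficient field does not occur in the type of the following set system, so it is
  passed as a type argument.\<close>

definition Delta :: "'k::field itself \<Rightarrow> 'v set set \<Rightarrow> 'v set set" where
  "Delta _ E = minus_set `
     (minimal_primes xy_ring (parity_binomial_edge_ideal E :: ('v, 'k) xy_poly set) - {p_plus})"

definition transversal :: "'v set \<Rightarrow> 'v set set \<Rightarrow> bool" where
  "transversal T F \<longleftrightarrow> (\<forall>e\<in>F. T \<inter> e \<noteq> {})"

definition transversal_number :: "'v set set \<Rightarrow> nat" where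
  "transversal_number F = (LEAST k. \<exists>T. transversal T F \<and> card T = k)"

end

theory Submission
  imports Defs
begin

text \<open>In the coordinates \<open>u\<^sub>i = x\<^sub>i - y\<^sub>i\<close>, \<open>w\<^sub>i = x\<^sub>i + y\<^sub>i\<close> the generators become
  \<open>u\<^sub>i w\<^sub>j + u\<^sub>j w\<^sub>i\<close> up to a factor 2, and \<open>p_plus\<close> is generated by the \<open>w\<^sub>i\<close>. For a vertex set
  \<open>T\<close> the following are equivalent: \<open>T\<close> is a transversal; every vertex \<open>j\<close> lies on an odd
  closed walk inside \<open>insert j T\<close>; the monomial \<open>\<Prod>i\<in>T. u\<^sub>i\<close> is annihilated by \<open>p_plus\<close> modulo the
  parity binomial edge ideal. An odd walk yields the annihilation by moving \<open>w\<close> along it. If there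
  is none at \<open>j\<close>, the 2-coloured component of \<open>j\<close> gives a family of zeros of the ideal on which
  \<open>w\<^sub>j\<close> and all \<open>u\<^sub>i\<close> with \<open>i \<in> T\<close> are nonzero, and whose closure contains points of the
  zero set of \<open>p_plus\<close> with \<open>u\<^sub>i \<noteq> 0\<close> for \<open>i \<in> T\<close>. Hence some minimal prime
  other than \<open>p_plus\<close> is missed by \<open>T\<close>. Moreover, an \<open>f\<close> whose colon ideal is \<open>p_plus\<close>
  vanishes on the family, hence on its closure, so \<open>T\<close> is not the support of a monomial of \<open>f\<close>
  modulo \<open>p_plus\<close>. No use is made of the ideal being radical.\<close>

section \<open>Ideals of a type-class ring\<close>

definition ideal_set :: "'a::comm_ring_1 set \<Rightarrow> bool" where
  "ideal_set J \<longleftrightarrow> 0 \<in> J \<and> (\<forall>a\<in>J. \<forall>b\<in>J. a + b \<in> J) \<and> (\<forall>r. \<forall>a\<in>J. r * a \<in> J)"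

lemma ideal_setD:
  assumes "ideal_set J"
  shows "0 \<in> J" "a \<in> J \<Longrightarrow> b \<in> J \<Longrightarrow> a + b \<in> J" "a \<in> J \<Longrightarrow> r * a \<in> J" "a \<in> J \<Longrightarrow> a * r \<in> J"
    "a \<in> J \<Longrightarrow> - a \<in> J" "a \<in> J \<Longrightarrow> b \<in> J \<Longrightarrow> a - b \<in> J"
proof -
  show *: "0 \<in> J" "a \<in> J \<Longrightarrow> b \<in> J \<Longrightarrow> a + b \<in> J" "a \<in> J \<Longrightarrow> r * a \<in> J" for a b r
    using assms by (auto simp: ideal_set_def)
  show "a \<in> J \<Longrightarrow> a * r \<in> J"
    using *(3)[of a r] by (simp add: mult.commute)
  show **: "a \<in> J \<Longrightarrow> - a \<in> J" for a
    using *(3)[of a "-1"] by simp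
  show "a \<in> J \<Longrightarrow> b \<in> J \<Longrightarrow> a - b \<in> J"
    using *(2)[of a "- b"] **[of b] by simp
qed

lemma ring_of_type_algebra_sel [simp]:
  "carrier ring_of_type_algebra = UNIV"
  "x \<otimes>\<^bsub>ring_of_type_algebra\<^esub> y = x * y"
  "x \<oplus>\<^bsub>ring_of_type_algebra\<^esub> y = x + y"
  "\<zero>\<^bsub>ring_of_type_algebra\<^esub> = 0"
  "\<one>\<^bsub>ring_of_type_algebra\<^esub> = 1"
  by (simp_all add: ring_of_type_algebra_def)

lemma ideal_ring_of_type_algebra_iff:
  fixes J :: "'a::comm_ring_1 set"
  shows "ideal J ring_of_type_algebra \<longleftrightarrow> ideal_set J"
proof
  assume "ideal J (ring_of_type_algebra :: 'a ring)"
  then interpret ideal J "ring_of_type_algebra :: 'a ring" .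
  show "ideal_set J"
    using additive_subgroup.zero_closed[OF is_additive_subgroup] I_l_closed
      additive_subgroup.a_closed[OF is_additive_subgroup]
    by (auto simp: ideal_set_def)
next
  assume J: "ideal_set J"
  let ?R = "ring_of_type_algebra :: 'a ring"
  interpret cring ?R
    by (rule cring_from_type_algebra)
  have inv: "inv\<^bsub>add_monoid ?R\<^esub> a \<in> J" if "a \<in> J" for a
  proof -
    have "\<ominus>\<^bsub>?R\<^esub> a = - a"
      by (rule minus_equality) simp_all
    then show ?thesis
      using ideal_setD(5)[OF J that] by (simp add: a_inv_def)
  qed
  show "ideal J ?R"
  proof (rule idealI)
    show "ring ?R" by (rule ring_axioms)
    show "subgroup J (add_monoid ?R)"
      by (rule subgroup.intro) (use inv ideal_setD[OF J] in auto)
  qed (use ideal_setD[OF J] in auto)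
qed

lemma primeideal_ring_of_type_algebra_iff:
  fixes J :: "'a::comm_ring_1 set"
  shows "primeideal J ring_of_type_algebra \<longleftrightarrow>
    ideal_set J \<and> 1 \<notin> J \<and> (\<forall>a b. a * b \<in> J \<longrightarrow> a \<in> J \<or> b \<in> J)"
proof
  assume "primeideal J (ring_of_type_algebra :: 'a ring)"
  then interpret primeideal J "ring_of_type_algebra :: 'a ring" .
  have "ideal_set J"
    using is_ideal by (simp add: ideal_ring_of_type_algebra_iff)
  moreover have "1 \<notin> J"
    using I_notcarr one_imp_carrier by auto
  ultimately show "ideal_set J \<and> 1 \<notin> J \<and> (\<forall>a b. a * b \<in> J \<longrightarrow> a \<in> J \<or> b \<in> J)"
    using I_prime by auto
next
  assume "ideal_set J \<and> 1 \<notin> J \<and> (\<forall>a b. a * b \<in> J \<longrightarrow> a \<in> J \<or> b \<in> J)"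
  then show "primeideal J (ring_of_type_algebra :: 'a ring)"
    by (intro primeidealI) (auto simp: ideal_ring_of_type_algebra_iff cring_from_type_algebra)
qed

lemma genideal_ring_of_type_algebra:
  fixes S :: "'a::comm_ring_1 set"
  shows "genideal ring_of_type_algebra S = \<Inter> {J. ideal_set J \<and> S \<subseteq> J}"
  by (simp add: genideal_def ideal_ring_of_type_algebra_iff)

lemma ideal_set_Inter: "(\<And>J. J \<in> F \<Longrightarrow> ideal_set J) \<Longrightarrow> ideal_set (\<Inter>F)"
  by (auto simp: ideal_set_def)

lemma ideal_set_genideal:
  fixes S :: "'a::comm_ring_1 set"
  shows "ideal_set (genideal ring_of_type_algebra S)"
  unfolding genideal_ring_of_type_algebra by (rule ideal_set_Inter) auto

lemma genideal_superset:
  fixes S :: "'a::comm_ring_1 set"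
  shows "S \<subseteq> genideal ring_of_type_algebra S"
  unfolding genideal_ring_of_type_algebra by auto

lemma genideal_least: "ideal_set J \<Longrightarrow> S \<subseteq> J \<Longrightarrow> genideal ring_of_type_algebra S \<subseteq> J"
  unfolding genideal_ring_of_type_algebra by auto

lemma primeideal_prodD:
  fixes P :: "'a::comm_ring_1 set"
  assumes P: "primeideal P ring_of_type_algebra" and "prod f A \<in> P"
  shows "\<exists>i\<in>A. f i \<in> P"
  using assms(2)
proof (induction A rule: infinite_finite_induct)
  case (insert i A)
  then have "f i \<in> P \<or> prod f A \<in> P"
    using P by (simp add: primeideal_ring_of_type_algebra_iff)
  with insert.IH show ?case
    by auto
\<comment> \<open>For empty or infinite \<open>A\<close> the product is \<open>1\<close>, which no
  prime contains.\<close>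
qed (use P in \<open>simp_all add: primeideal_ring_of_type_algebra_iff\<close>)

text \<open>Zorn's lemma applies because the intersection of a nonempty chain of primes is prime.
  Passing to complements turns minimal elements into maximal ones.\<close>

lemma minimal_prime_below_prime:
  fixes I P :: "'a::comm_ring_1 set"
  assumes "primeideal P ring_of_type_algebra" "I \<subseteq> P"
  obtains Q where "Q \<in> minimal_primes ring_of_type_algebra I" "Q \<subseteq> P"
proof -
  let ?R = "ring_of_type_algebra :: 'a ring"
  define A where "A = {- Q | Q. primeideal Q ?R \<and> I \<subseteq> Q \<and> Q \<subseteq> P}"
  have "\<exists>M\<in>A. \<forall>N\<in>A. M \<subseteq> N \<longrightarrow> N = M"
  proof (rule subset_Zorn_nonempty)
    show "A \<noteq> {}"
      using assms by (auto simp: A_def)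
    fix C assume "C \<noteq> {}" and C: "subset.chain A C"
    define F where "F = uminus ` C"
    have F: "primeideal Q ?R" "I \<subseteq> Q" "Q \<subseteq> P" if "Q \<in> F" for Q
      using that C by (auto simp: F_def A_def subset.chain_def)
    have chain: "Q \<subseteq> Q' \<or> Q' \<subseteq> Q" if "Q \<in> F" "Q' \<in> F" for Q Q'
      using that C by (auto simp: F_def subset.chain_def)
    have "F \<noteq> {}"
      using \<open>C \<noteq> {}\<close> by (simp add: F_def)
    have "primeideal (\<Inter>F) ?R"
      unfolding primeideal_ring_of_type_algebra_iff
    proof (intro conjI allI impI)
      show "ideal_set (\<Inter>F)"
        using F(1) by (intro ideal_set_Inter) (auto simp: primeideal_ring_of_type_algebra_iff)
      show "1 \<notin> \<Inter>F"
        using F(1) \<open>F \<noteq> {}\<close> by (auto simp: primeideal_ring_of_type_algebra_iff)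
      fix a b assume ab: "a * b \<in> \<Inter>F"
      show "a \<in> \<Inter>F \<or> b \<in> \<Inter>F"
      proof (rule ccontr)
        assume "\<not> ?thesis"
        then obtain Q Q' where Q: "Q \<in> F" "a \<notin> Q" "Q' \<in> F" "b \<notin> Q'"
          by auto
        \<comment> \<open>The smaller of the two primes in the chain misses both factors.\<close>
        then obtain Q'' where "Q'' \<in> F" "a \<notin> Q''" "b \<notin> Q''"
          using chain[of Q Q'] by auto
        then show False
          using ab F(1) by (auto simp: primeideal_ring_of_type_algebra_iff)
      qed
    qed
    moreover have "\<Union>C = - \<Inter>F"
      by (auto simp: F_def)
    moreover have "I \<subseteq> \<Inter>F" "\<Inter>F \<subseteq> P"
      using F(2,3) \<open>F \<noteq> {}\<close> by blast+
    ultimately show "\<Union>C \<in> A"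
      by (auto simp: A_def)
  qed
  then obtain M where M: "M \<in> A" "\<And>N. N \<in> A \<Longrightarrow> M \<subseteq> N \<Longrightarrow> N = M"
    by auto
  then obtain Q where Q: "primeideal Q ?R" "I \<subseteq> Q" "Q \<subseteq> P" and "M = - Q"
    by (auto simp: A_def)
  then have max: "N = - Q" if "N \<in> A" "- Q \<subseteq> N" for N
    using M that by auto
  have "Q' = Q" if "primeideal Q' ?R" "I \<subseteq> Q'" "Q' \<subseteq> Q" for Q'
  proof -
    have "- Q' \<in> A"
      using that Q(3) by (auto simp: A_def)
    then show ?thesis
      using max[of "- Q'"] that(3) by auto
  qed
  then have "Q \<in> minimal_primes ?R I"
    using Q unfolding minimal_primes_def by blast
  then show ?thesis
    using that Q(3) by blast
qed

section \<open>Substitution homomorphisms\<close>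

definition unital_hom :: "('a::comm_ring_1 \<Rightarrow> 'b::comm_ring_1) \<Rightarrow> bool" where
  "unital_hom H \<longleftrightarrow> H 1 = 1 \<and> (\<forall>a b. H (a + b) = H a + H b) \<and> (\<forall>a b. H (a * b) = H a * H b)"

lemma unital_homD:
  assumes "unital_hom H"
  shows "H 1 = 1" "H (a + b) = H a + H b" "H (a * b) = H a * H b" "H 0 = 0"
    "H (- a) = - H a" "H (a - b) = H a - H b"
proof -
  show *: "H 1 = 1" "H (a + b) = H a + H b" "H (a * b) = H a * H b" for a b
    using assms by (auto simp: unital_hom_def)
  show 0: "H 0 = 0"
    using *(2)[of 0 0] by simp
  show **: "H (- a) = - H a" for a
    using *(2)[of a "- a"] 0 by (simp add: eq_neg_iff_add_eq_0 add.commute)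
  show "H (a - b) = H a - H b"
    using *(2)[of a "- b"] **[of b] by simp
qed

lemma unital_hom_comp: "unital_hom H \<Longrightarrow> unital_hom K \<Longrightarrow> unital_hom (\<lambda>x. H (K x))"
  by (simp add: unital_hom_def)

lemma ideal_set_kernel: "unital_hom H \<Longrightarrow> ideal_set {a. H a = 0}"
  by (auto simp: ideal_set_def unital_homD)

lemma primeideal_kernel:
  fixes H :: "'a::comm_ring_1 \<Rightarrow> 'b::idom"
  assumes "unital_hom H"
  shows "primeideal {a. H a = 0} ring_of_type_algebra"
  using assms
  by (auto simp: primeideal_ring_of_type_algebra_iff ideal_set_kernel unital_homD)

text \<open>Serves twice, since polynomials and their exponent vectors are both finitely supported
  functions.\<close>

lemma poly_mapping_add_induct [case_names zero single add]:
  fixes p :: "'a \<Rightarrow>\<^sub>0 'b::comm_monoid_add"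
  assumes "P 0" "\<And>m c. P (Poly_Mapping.single m c)" "\<And>p q. P p \<Longrightarrow> P q \<Longrightarrow> P (p + q)"
  shows "P p"
proof -
  have p: "p = (\<Sum>m\<in>Poly_Mapping.keys p. Poly_Mapping.single m (Poly_Mapping.lookup p m))"
    by (rule poly_mapping_eqI)
      (simp add: lookup_sum lookup_single when_def in_keys_iff)
  have "P (\<Sum>m\<in>A. Poly_Mapping.single m (Poly_Mapping.lookup p m))" if "finite A" for A
    using that by induction (auto intro: assms)
  then show ?thesis
    by (subst p) simp
qed

abbreviation Const :: "'k::comm_ring_1 \<Rightarrow> ('a \<Rightarrow>\<^sub>0 nat) \<Rightarrow>\<^sub>0 'k" where
  "Const c \<equiv> Poly_Mapping.single 0 c"

abbreviation Var :: "'a \<Rightarrow> ('a \<Rightarrow>\<^sub>0 nat) \<Rightarrow>\<^sub>0 'k::comm_ring_1" where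
  "Var v \<equiv> Poly_Mapping.single (Poly_Mapping.single v 1) 1"

lemma mpoly_induct [case_names Const Var add mult]:
  fixes p :: "('a \<Rightarrow>\<^sub>0 nat) \<Rightarrow>\<^sub>0 'k::comm_ring_1"
  assumes const: "\<And>c. P (Const c)" and var: "\<And>v. P (Var v)"
    and add: "\<And>p q. P p \<Longrightarrow> P q \<Longrightarrow> P (p + q)"
    and mult: "\<And>p q. P p \<Longrightarrow> P q \<Longrightarrow> P (p * q)"
  shows "P p"
proof (induction p rule: poly_mapping_add_induct)
  case zero
  show ?case using const[of 0] by simp
next
  case (single m c)
  have power: "P (Poly_Mapping.single (Poly_Mapping.single v n) 1)" for v n
  proof (induction n)
    case 0
    show ?case using const[of 1] by simp
  next
    case (Suc n)
    have "Poly_Mapping.single (Poly_Mapping.single v (Suc n)) (1::'k) =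
        Var v * Poly_Mapping.single (Poly_Mapping.single v n) 1"
      by (simp add: mult_single flip: single_add)
    then show ?case using mult[OF var Suc] by simp
  qed
  have "P (Poly_Mapping.single m 1)"
  proof (induction m rule: poly_mapping_add_induct)
    case zero
    show ?case by (rule const)
  next
    case (single v n)
    show ?case by (rule power)
  next
    case (add m n)
    then show ?case using mult[OF add] by (simp add: mult_single)
  qed
  from mult[OF const[of c] this] show ?case
    by (simp add: mult_single)
next
  case (add p q)
  then show ?case by (rule assms)
qed

text \<open>The evaluation map from the universal property of a polynomial ring, with a change of
  coefficients along \<open>h\<close>.\<close>

definition subst :: "('k::comm_ring_1 \<Rightarrow> 'r::comm_ring_1) \<Rightarrow> ('a \<Rightarrow> 'r) \<Rightarrow>
    (('a \<Rightarrow>\<^sub>0 nat) \<Rightarrow>\<^sub>0 'k) \<Rightarrow> 'r" where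
  "subst h s p = (\<Sum>m\<in>Poly_Mapping.keys p. h (Poly_Mapping.lookup p m) *
     (\<Prod>v\<in>Poly_Mapping.keys m. s v ^ Poly_Mapping.lookup m v))"

context
  fixes h :: "'k::comm_ring_1 \<Rightarrow> 'r::comm_ring_1" and s :: "'a \<Rightarrow> 'r"
  assumes h: "unital_hom h"
begin

lemma subst_superset:
  assumes "finite A" "Poly_Mapping.keys p \<subseteq> A"
  shows "subst h s p = (\<Sum>m\<in>A. h (Poly_Mapping.lookup p m) *
     (\<Prod>v\<in>Poly_Mapping.keys m. s v ^ Poly_Mapping.lookup m v))"
  unfolding subst_def using assms
  by (intro sum.mono_neutral_left) (auto simp: in_keys_iff unital_homD[OF h])

lemma subst_add: "subst h s (p + q) = subst h s p + subst h s q"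
proof -
  let ?A = "Poly_Mapping.keys p \<union> Poly_Mapping.keys q"
  show ?thesis
    using subst_superset[of ?A, OF _ keys_add]
    by (simp add: subst_superset[of ?A] lookup_add unital_homD[OF h] algebra_simps sum.distrib)
qed

lemma subst_single: "subst h s (Poly_Mapping.single m c) =
    h c * (\<Prod>v\<in>Poly_Mapping.keys m. s v ^ Poly_Mapping.lookup m v)"
  by (subst subst_superset[of "{m}"]) auto

lemma monomial_value_superset:
  assumes "finite A" "Poly_Mapping.keys m \<subseteq> A"
  shows "(\<Prod>v\<in>Poly_Mapping.keys m. s v ^ Poly_Mapping.lookup m v) =
    (\<Prod>v\<in>A. s v ^ Poly_Mapping.lookup m v)"
  using assms by (intro prod.mono_neutral_left) (auto simp: in_keys_iff)

lemma monomial_value_add: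
  fixes m n :: "'a \<Rightarrow>\<^sub>0 nat"
  shows "(\<Prod>v\<in>Poly_Mapping.keys (m + n). s v ^ Poly_Mapping.lookup (m + n) v) =
    (\<Prod>v\<in>Poly_Mapping.keys m. s v ^ Poly_Mapping.lookup m v) *
    (\<Prod>v\<in>Poly_Mapping.keys n. s v ^ Poly_Mapping.lookup n v)"
proof -
  let ?A = "Poly_Mapping.keys m \<union> Poly_Mapping.keys n"
  show ?thesis
    using monomial_value_superset[of ?A, OF _ keys_add]
    by (simp add: monomial_value_superset[of ?A m] monomial_value_superset[of ?A n]
        lookup_add power_add prod.distrib)
qed

lemma subst_mult: "subst h s (p * q) = subst h s p * subst h s q"
proof (induction p rule: poly_mapping_add_induct)
  case (single m c)
  show ?case
    by (induction q rule: poly_mapping_add_induct)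
      (auto simp: mult_single subst_single subst_add monomial_value_add algebra_simps
        unital_homD[OF h] subst_def[of _ _ 0])
qed (auto simp: subst_add algebra_simps subst_def[of _ _ 0])

lemma unital_hom_subst: "unital_hom (subst h s)"
proof -
  have "subst h s 1 = 1"
    using subst_single[of 0 1] by (simp add: unital_homD[OF h])
  then show ?thesis
    by (simp add: unital_hom_def subst_add subst_mult)
qed

lemma subst_Const: "subst h s (Const c) = h c"
  by (simp add: subst_single)

lemma subst_Var: "subst h s (Var v) = s v"
  by (simp add: subst_single unital_homD[OF h])

end

text \<open>Products are covered by \<open>H p * H q - K p * K q = H p * (H q - K q) + (H p - K p) *
  K q\<close>. With \<open>J = {0}\<close> this gives equality of homomorphisms.\<close>

lemma homs_congruent:
  fixes H K :: "(('a \<Rightarrow>\<^sub>0 nat) \<Rightarrow>\<^sub>0 'k::comm_ring_1) \<Rightarrow> 'r::comm_ring_1"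
  assumes "unital_hom H" "unital_hom K" "ideal_set J"
    and "\<And>c. H (Const c) - K (Const c) \<in> J" "\<And>v. H (Var v) - K (Var v) \<in> J"
  shows "H p - K p \<in> J"
proof (induction p rule: mpoly_induct)
  case (add p q)
  then have "(H p - K p) + (H q - K q) \<in> J"
    using assms(3) by (simp add: ideal_setD)
  then show ?case
    using assms(1,2) by (simp add: unital_homD algebra_simps)
next
  case (mult p q)
  then have "H p * (H q - K q) + (H p - K p) * K q \<in> J"
    using assms(3) by (simp add: ideal_setD)
  then show ?case
    using assms(1,2) by (simp add: unital_homD algebra_simps)
qed (use assms in auto)

lemma unital_hom_Const: "unital_hom Const"
  by (simp add: unital_hom_def single_add mult_single)

lemma unital_hom_id: "unital_hom (\<lambda>x. x)"
  by (simp add: unital_hom_def)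

section \<open>Homogeneous polynomials\<close>

definition mdeg :: "('a \<Rightarrow>\<^sub>0 nat) \<Rightarrow> nat" where
  "mdeg m = (\<Sum>v\<in>Poly_Mapping.keys m. Poly_Mapping.lookup m v)"

lemma mdeg_superset:
  assumes "finite A" "Poly_Mapping.keys m \<subseteq> A"
  shows "mdeg m = (\<Sum>v\<in>A. Poly_Mapping.lookup m v)"
  unfolding mdeg_def using assms by (intro sum.mono_neutral_left) (auto simp: in_keys_iff)

lemma mdeg_add: "mdeg (m + n) = mdeg m + mdeg n"
proof -
  let ?A = "Poly_Mapping.keys m \<union> Poly_Mapping.keys n"
  show ?thesis
    using mdeg_superset[of ?A, OF _ keys_add]
    by (simp add: mdeg_superset[of ?A m] mdeg_superset[of ?A n] lookup_add sum.distrib)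
qed

text \<open>Graded pieces over any set of variables, because \<open>spec_hom\<close> leads to
  variables indexed by \<open>nat\<close>.\<close>

definition homog :: "nat \<Rightarrow> (('a \<Rightarrow>\<^sub>0 nat) \<Rightarrow>\<^sub>0 'k::comm_ring_1) set" where
  "homog d = {f. \<forall>m\<in>Poly_Mapping.keys f. mdeg m = d}"

lemma graded_piece_eq_homog: "graded_piece d = homog d"
  by (simp add: graded_piece_def homog_def mdeg_def)

lemma homog_Const: "Const c \<in> homog 0"
  by (simp add: homog_def mdeg_def)

lemma homog_Var: "Var v \<in> homog 1"
  by (simp add: homog_def mdeg_def)

lemma homog_zero: "0 \<in> homog d"
  by (simp add: homog_def)

lemma homog_uminus: "f \<in> homog d \<Longrightarrow> - f \<in> homog d"
  by (simp add: homog_def in_keys_iff)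

lemma homog_add: "f \<in> homog d \<Longrightarrow> g \<in> homog d \<Longrightarrow> f + g \<in> homog d"
  using keys_add[of f g] by (auto simp: homog_def)

lemma homog_diff: "f \<in> homog d \<Longrightarrow> g \<in> homog d \<Longrightarrow> f - g \<in> homog d"
  using homog_add[of f d "- g"] homog_uminus[of g d] by simp

lemma homog_mult: "f \<in> homog d \<Longrightarrow> g \<in> homog d' \<Longrightarrow> f * g \<in> homog (d + d')"
  unfolding homog_def
proof (intro CollectI ballI)
  fix m assume fg: "f \<in> {f. \<forall>m\<in>Poly_Mapping.keys f. mdeg m = d}"
    "g \<in> {f. \<forall>m\<in>Poly_Mapping.keys f. mdeg m = d'}"
  assume "m \<in> Poly_Mapping.keys (f * g)"
  then obtain a b where "m = a + b" "a \<in> Poly_Mapping.keys f" "b \<in> Poly_Mapping.keys g"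
    using keys_mult[of f g] by auto
  with fg show "mdeg m = d + d'"
    by (simp add: mdeg_add)
qed

lemma homog_sum: "(\<And>i. i \<in> A \<Longrightarrow> f i \<in> homog d) \<Longrightarrow> sum f A \<in> homog d"
  by (induction A rule: infinite_finite_induct) (auto simp: homog_zero homog_add)

lemma homog_prod: "(\<And>i. i \<in> A \<Longrightarrow> f i \<in> homog (d i)) \<Longrightarrow> prod f A \<in> homog (sum d A)"
  by (induction A rule: infinite_finite_induct) (use homog_Const[of 1] in \<open>auto simp: homog_mult\<close>)

lemma homog_power: "f \<in> homog d \<Longrightarrow> f ^ n \<in> homog (n * d)"
  by (induction n) (use homog_Const[of 1] in \<open>auto simp: homog_mult\<close>)

lemma homog_subst_linear:
  assumes "f \<in> homog d" "\<And>v. s v \<in> homog 1"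
  shows "subst Const s f \<in> homog d"
  unfolding subst_def
proof (rule homog_sum)
  fix m assume "m \<in> Poly_Mapping.keys f"
  then have "mdeg m = d"
    using assms(1) by (simp add: homog_def)
  moreover have "(\<Prod>v\<in>Poly_Mapping.keys m. s v ^ Poly_Mapping.lookup m v) \<in> homog (mdeg m)"
    unfolding mdeg_def using homog_power[OF assms(2)] by (intro homog_prod) simp
  ultimately show "Const (Poly_Mapping.lookup f m) *
      (\<Prod>v\<in>Poly_Mapping.keys m. s v ^ Poly_Mapping.lookup m v) \<in> homog d"
    using homog_mult[OF homog_Const] by fastforce
qed

section \<open>The ideals\<close>

abbreviation u :: "'v \<Rightarrow> ('v, 'k::field) xy_poly" where
  "u i \<equiv> var_x i - var_y i"

abbreviation w :: "'v \<Rightarrow> ('v, 'k::field) xy_poly" where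
  "w i \<equiv> var_x i + var_y i"

lemma var_x_eq: "var_x i = Var (Inl i)"
  by (simp add: var_x_def)

lemma var_y_eq: "var_y i = Var (Inr i)"
  by (simp add: var_y_def)

lemma ideal_set_parity: "ideal_set (parity_binomial_edge_ideal G)"
  unfolding parity_binomial_edge_ideal_def by (rule ideal_set_genideal)

lemma parity_generator:
  "{i, j} \<in> G \<Longrightarrow> var_x i * var_x j - var_y i * var_y j \<in> parity_binomial_edge_ideal G"
  unfolding parity_binomial_edge_ideal_def by (rule subsetD[OF genideal_superset]) blast

lemma parity_least:
  assumes "ideal_set J"
    and "\<And>i j. {i, j} \<in> G \<Longrightarrow> var_x i * var_x j - var_y i * var_y j \<in> J"
  shows "parity_binomial_edge_ideal G \<subseteq> J"
  unfolding parity_binomial_edge_ideal_def using assms by (intro genideal_least) auto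

lemma ideal_set_p_plus: "ideal_set p_plus"
  unfolding p_plus_def by (rule ideal_set_genideal)

lemma w_in_p_plus: "w i \<in> p_plus"
  unfolding p_plus_def by (rule subsetD[OF genideal_superset]) simp

lemma p_plus_least: "ideal_set J \<Longrightarrow> (\<And>i. w i \<in> J) \<Longrightarrow> p_plus \<subseteq> J"
  unfolding p_plus_def by (intro genideal_least) auto

text \<open>The domain property of polynomial rings is only available for linearly ordered sets of
  variables, so the variables are numbered by an injection \<open>e\<close> into \<open>nat\<close>.
  On the quotient by \<open>p_plus\<close> this is the map killing the variables indexed by \<open>N\<close>.\<close>

definition spec_hom :: "('v \<Rightarrow> nat) \<Rightarrow> 'v set \<Rightarrow> ('v, 'k::field) xy_poly \<Rightarrow>
    (nat \<Rightarrow>\<^sub>0 nat) \<Rightarrow>\<^sub>0 'k" where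
  "spec_hom e N = subst Const
     (case_sum (\<lambda>i. if i \<in> N then 0 else Var (e i)) (\<lambda>i. if i \<in> N then 0 else - Var (e i)))"

lemma unital_hom_spec_hom: "unital_hom (spec_hom e N)"
  unfolding spec_hom_def by (rule unital_hom_subst[OF unital_hom_Const])

lemma spec_hom_simps [simp]:
  "spec_hom e N (Const c) = Const c"
  "spec_hom e N (Var (Inl i)) = (if i \<in> N then 0 else Var (e i))"
  "spec_hom e N (Var (Inr i)) = (if i \<in> N then 0 else - Var (e i))"
  by (simp_all only: spec_hom_def subst_Const[OF unital_hom_Const] subst_Var[OF unital_hom_Const]
      sum.case)

text \<open>Modulo \<open>p_plus\<close> every \<open>y_i\<close> is \<open>- x_i\<close>, so the
  quotient is a polynomial ring in the \<open>x_i\<close>. As a kernel into a domain,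
  \<open>p_plus\<close> is then prime.\<close>

lemma p_plus_eq_kernel:
  fixes e :: "'v \<Rightarrow> nat"
  assumes "inj e"
  shows "(p_plus :: ('v, 'k::field) xy_poly set) = {f. spec_hom e {} f = 0}" (is "?P = ?K")
proof
  show "?P \<subseteq> ?K"
    by (rule p_plus_least[OF ideal_set_kernel[OF unital_hom_spec_hom]])
      (simp add: unital_homD[OF unital_hom_spec_hom] var_x_eq var_y_eq del: One_nat_def)
  \<comment> \<open>Sends each variable back to its \<open>x_i\<close>. After
    \<open>spec_hom e {}\<close> this is the identity modulo \<open>p_plus\<close>, so
    \<open>- f\<close> lies in \<open>p_plus\<close> for every \<open>f\<close> in the
    kernel.\<close>
  define unspec :: "((nat \<Rightarrow>\<^sub>0 nat) \<Rightarrow>\<^sub>0 'k) \<Rightarrow> ('v, 'k) xy_poly"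
    where "unspec = subst Const (\<lambda>n. var_x (inv_into UNIV e n))"
  have unspec: "unital_hom unspec"
    unfolding unspec_def by (rule unital_hom_subst[OF unital_hom_Const])
  have unspec_simps: "unspec (Const c) = Const c" "unspec (Var n) = var_x (inv_into UNIV e n)" for c n
    by (simp_all only: unspec_def subst_Const[OF unital_hom_Const] subst_Var[OF unital_hom_Const])
  have *: "unspec (spec_hom e {} f) - f \<in> p_plus" for f :: "('v, 'k) xy_poly"
  proof (rule homs_congruent[OF unital_hom_comp[OF unspec unital_hom_spec_hom] unital_hom_id
        ideal_set_p_plus])
    fix v :: "'v + 'v"
    show "unspec (spec_hom e {} (Var v)) - Var v \<in> p_plus"
    proof (cases v)
      case (Inl i)
      then show ?thesis
        using assms by (simp add: unspec_simps var_x_eq ideal_setD[OF ideal_set_p_plus] del: One_nat_def)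
    next
      case (Inr i)
      then have "unspec (spec_hom e {} (Var v)) - Var v = - w i"
        using assms
        by (simp add: unspec_simps unital_homD[OF unspec] var_x_eq var_y_eq del: One_nat_def)
      then show ?thesis
        using ideal_setD(5)[OF ideal_set_p_plus w_in_p_plus] by metis
    qed
  qed (simp add: unspec_simps ideal_setD[OF ideal_set_p_plus])
  show "?K \<subseteq> ?P"
  proof (intro subsetI)
    fix f :: "('v, 'k) xy_poly"
    assume "f \<in> ?K"
    then have "- f \<in> p_plus"
      using *[of f] by (simp add: unital_homD(4)[OF unspec])
    then show "f \<in> p_plus"
      using ideal_setD(5)[OF ideal_set_p_plus, of "- f"] by simp
  qed
qed

lemma exists_numbering: "\<exists>e :: 'v::finite \<Rightarrow> nat. inj e"
  using finite_imp_inj_to_nat_seg[of "UNIV :: 'v set"] by auto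

lemma primeideal_p_plus: "primeideal (p_plus :: ('v::finite, 'k::field) xy_poly set) xy_ring"
proof -
  obtain e :: "'v \<Rightarrow> nat" where "inj e"
    using exists_numbering by blast
  then show ?thesis
    by (simp only: p_plus_eq_kernel primeideal_kernel unital_hom_spec_hom)
qed

text \<open>Killing variables affects only the monomials in which one of them occurs.\<close>

lemma lookup_spec_hom:
  assumes "Poly_Mapping.keys a \<inter> e ` N = {}"
  shows "Poly_Mapping.lookup (spec_hom e N f) a = Poly_Mapping.lookup (spec_hom e {} f) a"
proof -
  \<comment> \<open>The ideal generated by the killed variables, described by its monomials; both
    homomorphisms agree modulo it.\<close>
  define J :: "((nat \<Rightarrow>\<^sub>0 nat) \<Rightarrow>\<^sub>0 'b) set"
    where "J = {F. \<forall>m\<in>Poly_Mapping.keys F. Poly_Mapping.keys m \<inter> e ` N \<noteq> {}}"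
  have keys_plus: "Poly_Mapping.keys (m + n) = Poly_Mapping.keys m \<union> Poly_Mapping.keys n"
    for m n :: "nat \<Rightarrow>\<^sub>0 nat"
    by (auto simp: in_keys_iff lookup_add)
  have J: "ideal_set J"
    unfolding ideal_set_def
  proof (intro conjI ballI allI)
    fix F G assume "F \<in> J" "G \<in> J"
    then show "F + G \<in> J"
      using keys_add[of F G] unfolding J_def by blast
  next
    fix F G assume "F \<in> J"
    then show "G * F \<in> J"
      unfolding J_def
    proof (intro CollectI ballI)
      fix m assume "m \<in> Poly_Mapping.keys (G * F)"
      then obtain a b where "m = a + b" "b \<in> Poly_Mapping.keys F"
        using keys_mult[of G F] by auto
      then show "Poly_Mapping.keys m \<inter> e ` N \<noteq> {}"
        using \<open>F \<in> J\<close> by (auto simp: J_def keys_plus)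
    qed
  qed (simp add: J_def)
  have "spec_hom e {} f - spec_hom e N f \<in> J"
  proof (rule homs_congruent[OF unital_hom_spec_hom unital_hom_spec_hom J])
    fix v :: "'a + 'a"
    show "spec_hom e {} (Var v) - spec_hom e N (Var v) \<in> J"
      using ideal_setD(1)[OF J] by (cases v) (auto simp del: One_nat_def, auto simp: J_def)
  qed (simp add: ideal_setD[OF J])
  then have "Poly_Mapping.lookup (spec_hom e {} f - spec_hom e N f) a = 0"
    using assms by (auto simp: J_def simp flip: not_in_keys_iff_lookup_eq_zero)
  then show ?thesis
    by (simp add: lookup_minus)
qed

section \<open>Signed walks\<close>

text \<open>The second component records the parity of the length of a walk inside \<open>S\<close>.\<close>

definition signed_step :: "'v set set \<Rightarrow> 'v set \<Rightarrow> (('v \<times> bool) \<times> ('v \<times> bool)) set" where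
  "signed_step G S = {((k, s), (l, \<not> s)) | k l s. {k, l} \<in> G \<and> k \<in> S \<and> l \<in> S}"

text \<open>\<open>signed_step\<close> is adjacency in the bipartite double cover of the induced
  subgraph. Both lifts of \<open>j\<close> being connected means that the component of
  \<open>j\<close> in the graph induced on \<open>insert j T\<close> is not bipartite.\<close>

definition odd_dominating :: "'v set set \<Rightarrow> 'v set \<Rightarrow> bool" where
  "odd_dominating G T \<longleftrightarrow> (\<forall>j. ((j, True), (j, False)) \<in> (signed_step G (insert j T))\<^sup>*)"

text \<open>Exchanging the two sheets is an automorphism of the double cover.\<close>

lemma signed_walk_flip:
  assumes "((k, s), (l, t)) \<in> (signed_step G S)\<^sup>*"
  shows "((k, \<not> s), (l, \<not> t)) \<in> (signed_step G S)\<^sup>*"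
  using assms
proof (induction rule: rtrancl_induct2)
  case (step k' s' l' t')
  then have "((k', \<not> s'), (l', \<not> t')) \<in> signed_step G S"
    by (auto simp: signed_step_def)
  with step.IH show ?case by (rule rtrancl_into_rtrancl)
qed simp

lemma signed_walk_sym:
  assumes "((k, s), (l, t)) \<in> (signed_step G S)\<^sup>*"
  shows "((l, t), (k, s)) \<in> (signed_step G S)\<^sup>*"
proof -
  have "sym (signed_step G S)"
    by (auto simp: sym_def signed_step_def insert_commute)
  then show ?thesis
    using assms sym_rtrancl symD by metis
qed

text \<open>Two walks from \<open>j\<close> to \<open>k\<close> of different parity would close up
  to an odd walk at \<open>j\<close>. Hence the sign is a 2-colouring of the component of
  \<open>j\<close>.\<close>

lemma signed_walk_unique_sign:
  assumes "((j, True), (j, False)) \<notin> (signed_step G S)\<^sup>*"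
    and "((j, True), (k, s)) \<in> (signed_step G S)\<^sup>*" "((j, True), (k, t)) \<in> (signed_step G S)\<^sup>*"
  shows "s = t"
proof (rule ccontr)
  assume "s \<noteq> t"
  then have "((k, s), (j, False)) \<in> (signed_step G S)\<^sup>*"
    using signed_walk_flip[OF signed_walk_sym[OF assms(3)]] by simp
  with assms(1,2) show False
    by (meson rtrancl_trans)
qed

text \<open>Without an odd closed walk at \<open>j\<close>, the parity of walks from
  \<open>j\<close> would 2-colour the whole connected graph. This ensures that there are candidates
  to minimize over.\<close>

lemma odd_dominating_UNIV:
  assumes "connected_graph G" "\<not> bipartite_graph G"
  shows "odd_dominating G UNIV"
proof (rule ccontr)
  assume "\<not> ?thesis"
  then obtain j where j: "((j, True), (j, False)) \<notin> (signed_step G UNIV)\<^sup>*"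
    by (auto simp: odd_dominating_def)
  let ?W = "\<lambda>k s. ((j, True), (k, s)) \<in> (signed_step G UNIV)\<^sup>*"
  have step: "?W l (\<not> s)" if "?W k s" "{k, l} \<in> G" for k l s
    using that by (intro rtrancl_into_rtrancl[OF that(1)]) (auto simp: signed_step_def)
  have reach: "\<exists>s. ?W k s" for k
  proof -
    have "(j, k) \<in> {(a, b). {a, b} \<in> G}\<^sup>*"
      using assms(1) by (simp add: connected_graph_def)
    then show ?thesis
      by induction (use step in blast)+
  qed
  have "k \<in> {k. ?W k True} \<longleftrightarrow> l \<notin> {k. ?W k True}" if "{k, l} \<in> G" for k l
  proof -
    obtain s where "?W k s"
      using reach by blast
    then show ?thesis
      using step[OF _ that] signed_walk_unique_sign[OF j] by (cases s) fastforce+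
  qed
  then have "bipartite_graph G"
    unfolding bipartite_graph_def by blast
  with assms(2) show False ..
qed

section \<open>Odd walks and the annihilation of squarefree monomials\<close>

lemma two_neq_zero:
  assumes "CHAR('k::field) \<noteq> 2"
  shows "(2 :: 'k) \<noteq> 0"
proof
  assume "(2 :: 'k) = 0"
  then have "of_nat 2 = (0 :: 'k)"
    by simp
  then have "CHAR('k) dvd 2"
    by (simp only: of_nat_eq_0_iff_char_dvd)
  moreover have "CHAR('k) \<noteq> 1"
    by simp
  ultimately show False
    using assms two_is_prime_nat unfolding prime_nat_iff by blast
qed

text \<open>With respect to the coordinates \<open>u\<close>, \<open>w\<close> an edge is a relation
  \<open>w\<^sub>k u\<^sub>l \<equiv> - w\<^sub>l u\<^sub>k\<close>, so moving \<open>w\<close> along a walk inside the squarefree monomial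
  only changes the sign, and an odd closed walk makes the monomial 2-torsion.\<close>

lemma signed_walk_congruence:
  fixes G :: "'v::finite set set"
  assumes "simple_graph G" "((j, True), (k, s)) \<in> (signed_step G S)\<^sup>*"
  shows "w j * prod u (S - {j}) - (if s then 1 else - 1) * (w k * prod u (S - {k}))
    \<in> (parity_binomial_edge_ideal G :: ('v, 'k::field) xy_poly set)" (is "_ \<in> ?I")
  using assms(2)
proof (induction rule: rtrancl_induct2)
  case refl
  show ?case
    by (simp add: ideal_setD[OF ideal_set_parity])
next
  case (step k s l t)
  then have kl: "{k, l} \<in> G" "k \<in> S" "l \<in> S" "t = (\<not> s)"
    by (auto simp: signed_step_def)
  then have "k \<noteq> l"
    using assms(1) by (force simp: simple_graph_def)
  define p where "p = (prod u (S - {k, l}) :: ('v, 'k) xy_poly)"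
  have "S - {k} - {l} = S - {k, l}" "S - {l} - {k} = S - {k, l}"
    by auto
  then have split: "prod u (S - {k}) = u l * p" "prod u (S - {l}) = u k * p"
    using kl \<open>k \<noteq> l\<close> prod.remove[of "S - {k}" l] prod.remove[of "S - {l}" k]
    by (auto simp: p_def)
  define M :: "('v, 'k) xy_poly" where "M = w k * prod u (S - {k}) + w l * prod u (S - {l})"
  \<comment> \<open>\<open>w k * u l + w l * u k\<close> is twice the generator of the edge; the
    mixed terms cancel.\<close>
  have "M = 2 * p * (var_x k * var_x l - var_y k * var_y l)"
    by (simp add: M_def split algebra_simps)
  then have "M \<in> ?I"
    using ideal_setD(3)[OF ideal_set_parity parity_generator[OF kl(1)]] by simp
  then have "(if s then 1 else - 1) * M \<in> ?I"
    by (rule ideal_setD(3)[OF ideal_set_parity])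
  from ideal_setD(2)[OF ideal_set_parity step.IH this] show ?case
    by (cases s) (simp_all add: M_def kl(4) algebra_simps)
qed

text \<open>An odd closed walk brings \<open>w j\<close> back with the opposite sign, so
  \<open>2 * M\<close> lies in the ideal, and \<open>2\<close> is invertible.\<close>

lemma w_times_prod_u_in_parity:
  fixes G :: "'v::finite set set"
  assumes "CHAR('k::field) \<noteq> 2" "simple_graph G" "odd_dominating G T"
  shows "w j * prod u T \<in> (parity_binomial_edge_ideal G :: ('v, 'k) xy_poly set)" (is "_ \<in> ?I")
proof -
  let ?S = "insert j T"
  define M where "M = (w j * prod u (?S - {j}) :: ('v, 'k) xy_poly)"
  have "((j, True), (j, False)) \<in> (signed_step G ?S)\<^sup>*"
    using assms(3) by (simp add: odd_dominating_def)
  from signed_walk_congruence[OF assms(2) this] have "2 * M \<in> ?I"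
    by (simp add: M_def algebra_simps)
  then have "Const (1 / 2) * (2 * M) \<in> ?I"
    by (rule ideal_setD(3)[OF ideal_set_parity])
  moreover have "Const (1 / 2) * (2 * M) = M"
  proof -
    have "Const (1 / 2) * 2 = (1 :: ('v, 'k) xy_poly)"
      using two_neq_zero[OF assms(1)] mult_single[of 0 "1 / 2 :: 'k" 0 2]
      by (simp del: mult_single)
    then show ?thesis
      by (simp flip: mult.assoc)
  qed
  ultimately have M: "M \<in> ?I"
    by simp
  show ?thesis
  proof (cases "j \<in> T")
    case True
    \<comment> \<open>Here the walk only controls the product without the factor \<open>u j\<close>,
      which is multiplied back in.\<close>
    then have "w j * prod u T = u j * M"
      by (simp add: M_def insert_absorb prod.remove[of T j] algebra_simps)
    then show ?thesis
      using ideal_setD(3)[OF ideal_set_parity M] by simp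
  next
    case False
    then show ?thesis
      using M by (simp add: M_def)
  qed
qed

text \<open>On the component \<open>C\<close> of \<open>j\<close> in the graph induced on \<open>insert j T\<close>, which carries a
  2-colouring, \<open>w\<close> becomes \<open>\<plusminus>z u\<close>; outside \<open>C\<close> it becomes \<open>0\<close>, and so does \<open>u\<close> on the
  neighbours of \<open>C\<close>. The parameter \<open>z\<close> degenerates this to a point of the zero set of
  \<open>p_plus\<close>.\<close>

lemma separating_hom:
  fixes G :: "'v set set" and e :: "'v \<Rightarrow> nat"
  assumes char: "CHAR('k::field) \<noteq> 2"
    and j: "((j, True), (j, False)) \<notin> (signed_step G (insert j T))\<^sup>*"
  obtains \<Phi> :: "('v, 'k::field) xy_poly \<Rightarrow> ((nat \<Rightarrow>\<^sub>0 nat) \<Rightarrow>\<^sub>0 'k) poly" and N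
  where "unital_hom \<Phi>" "\<forall>f\<in>parity_binomial_edge_ideal G. \<Phi> f = 0"
    "\<Phi> (w j) \<noteq> 0" "\<forall>i\<in>T. \<Phi> (u i) \<noteq> 0" "N \<inter> T = {}"
    "\<forall>f. poly (\<Phi> f) 0 = spec_hom e N f"
proof -
  let ?S = "insert j T"
  let ?W = "\<lambda>k s. ((j, True), (k, s)) \<in> (signed_step G ?S)\<^sup>*"
  define C where "C = {k. \<exists>s. ?W k s}"
  define N where "N = {i. i \<notin> C \<and> (\<exists>k\<in>C. {i, k} \<in> G)}"
  \<comment> \<open>\<open>t i\<close> and \<open>z i\<close> will be half the images of
    \<open>u i\<close> and \<open>w i\<close>, so that an edge \<open>{i, k}\<close> demands
    \<open>t i * z k + t k * z i = 0\<close>.\<close>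
  define t :: "'v \<Rightarrow> ((nat \<Rightarrow>\<^sub>0 nat) \<Rightarrow>\<^sub>0 'k) poly"
    where "t i = (if i \<in> N then 0 else [:Var (e i):])" for i
  \<comment> \<open>\<open>[:0, 1:]\<close> is the degeneration parameter, and the sign is the
    colour of \<open>i\<close>.\<close>
  define z :: "'v \<Rightarrow> ((nat \<Rightarrow>\<^sub>0 nat) \<Rightarrow>\<^sub>0 'k) poly"
    where "z i = (if i \<notin> C then 0 else if ?W i True then [:0, 1:] * t i else - ([:0, 1:] * t i))" for i
  define \<Phi> where "\<Phi> = subst (\<lambda>c. [:Const c:]) (case_sum (\<lambda>i. t i + z i) (\<lambda>i. z i - t i))"
  have const: "unital_hom (\<lambda>c::'k. [:Const c:] :: ((nat \<Rightarrow>\<^sub>0 nat) \<Rightarrow>\<^sub>0 'k) poly)"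
    by (simp add: unital_hom_def single_add mult_single one_pCons mult.commute)
  have hom: "unital_hom \<Phi>"
    unfolding \<Phi>_def by (rule unital_hom_subst[OF const])
  have vals: "\<Phi> (var_x i) = t i + z i" "\<Phi> (var_y i) = z i - t i" "\<Phi> (Const c) = [:Const c:]" for i c
    by (simp_all only: \<Phi>_def var_x_eq var_y_eq subst_Var[OF const] subst_Const[OF const] sum.case)
  have sign: "?W k True \<longleftrightarrow> s" if "?W k s" for k s
    using signed_walk_unique_sign[OF j that, of True] that by (cases s) (simp_all, blast?)
  have "j \<in> C" "?W j True"
    by (auto simp: C_def)
  have C_sub: "k \<in> ?S" if "k \<in> C" for k
  proof -
    have "k \<in> ?S" if "?W k s" for s
      using that by cases (auto simp: signed_step_def)
    then show ?thesis
      using \<open>k \<in> C\<close> by (auto simp: C_def)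
  qed
  have step: "?W l (\<not> s)" if "?W k s" "{k, l} \<in> G" "k \<in> ?S" "l \<in> ?S" for k l s
    by (rule rtrancl_into_rtrancl[OF that(1)]) (use that in \<open>auto simp: signed_step_def\<close>)
  have C_closed: "l \<in> C" if "k \<in> C" "{k, l} \<in> G" "l \<in> ?S" for k l
  proof -
    obtain s where "?W k s"
      using \<open>k \<in> C\<close> by (auto simp: C_def)
    from step[OF this that(2) C_sub[OF that(1)] that(3)] show ?thesis
      by (auto simp: C_def)
  qed
  have N_disj: "N \<inter> ?S = {}"
  proof (intro equals0I)
    fix i assume "i \<in> N \<inter> ?S"
    then obtain k where "i \<notin> C" "i \<in> ?S" "k \<in> C" "{k, i} \<in> G"
      by (auto simp: N_def insert_commute)
    then show False
      using C_closed by blast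
  qed
  \<comment> \<open>Inside \<open>C\<close> the ends have opposite signs and the terms cancel. On an
    edge leaving \<open>C\<close> both \<open>t k\<close> and \<open>z k\<close> vanish.\<close>
  have edge_half: "t i * z k + t k * z i = 0" if "{i, k} \<in> G" "i \<in> C" for i k
  proof (cases "k \<in> C")
    case True
    obtain s where i: "?W i s"
      using \<open>i \<in> C\<close> by (auto simp: C_def)
    have k: "?W k (\<not> s)"
      by (rule step[OF i that(1) C_sub[OF that(2)] C_sub[OF True]])
    show ?thesis
      using True that(2) by (cases s) (simp_all add: z_def sign[OF i] sign[OF k] algebra_simps)
  next
    case False
    then have "k \<in> N"
      using that by (auto simp: N_def insert_commute)
    then show ?thesis
      using False by (simp add: z_def t_def)
  qed
  have edge: "t i * z k + t k * z i = 0" if "{i, k} \<in> G" for i k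
    using edge_half[of i k] edge_half[of k i] that
    by (cases "i \<in> C"; cases "k \<in> C") (auto simp: insert_commute add.commute z_def)
  have zero: "\<Phi> f = 0" if "f \<in> parity_binomial_edge_ideal G" for f
  proof -
    have "\<Phi> (var_x i * var_x k - var_y i * var_y k) = 0" if "{i, k} \<in> G" for i k
    proof -
      have "\<Phi> (var_x i * var_x k - var_y i * var_y k) = 2 * (t i * z k + t k * z i)"
        by (simp add: unital_homD[OF hom] vals algebra_simps)
      then show ?thesis
        by (simp add: edge[OF that])
    qed
    then show ?thesis
      using parity_least[OF ideal_set_kernel[OF hom], of G] that by auto
  qed
  have two: "(2 :: ((nat \<Rightarrow>\<^sub>0 nat) \<Rightarrow>\<^sub>0 'k) poly) \<noteq> 0"
  proof -
    have "Poly_Mapping.lookup (2 :: (nat \<Rightarrow>\<^sub>0 nat) \<Rightarrow>\<^sub>0 'k) 0 \<noteq> 0"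
      using two_neq_zero[OF char] by (simp add: lookup_numeral)
    then have "(2 :: (nat \<Rightarrow>\<^sub>0 nat) \<Rightarrow>\<^sub>0 'k) \<noteq> 0"
      by (metis lookup_zero)
    then have "coeff (2 :: ((nat \<Rightarrow>\<^sub>0 nat) \<Rightarrow>\<^sub>0 'k) poly) 0 \<noteq> 0"
      by (simp add: numeral_poly)
    then show ?thesis
      by force
  qed
  have t_nz: "t i \<noteq> 0" if "i \<in> ?S" for i
  proof -
    have "Poly_Mapping.lookup (Var (e i)) (Poly_Mapping.single (e i) 1) \<noteq> (0 :: 'k)"
      by simp
    then have "Var (e i) \<noteq> (0 :: (nat \<Rightarrow>\<^sub>0 nat) \<Rightarrow>\<^sub>0 'k)"
      by (metis lookup_zero)
    moreover have "i \<notin> N"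
      using N_disj that by blast
    ultimately show ?thesis
      by (simp add: t_def)
  qed
  have "\<Phi> (w j) = 2 * z j"
    by (simp add: unital_homD[OF hom] vals algebra_simps)
  moreover have "z j = [:0, 1:] * t j"
    using \<open>j \<in> C\<close> by (simp add: z_def)
  ultimately have w: "\<Phi> (w j) \<noteq> 0"
    using two t_nz[of j] by (simp del: mult_pCons_left)
  have u: "\<Phi> (u i) \<noteq> 0" if "i \<in> T" for i
  proof -
    have "\<Phi> (u i) = 2 * t i"
      by (simp add: unital_homD[OF hom] vals algebra_simps)
    then show ?thesis
      using two t_nz[of i] that by simp
  qed
  \<comment> \<open>At parameter \<open>0\<close> all \<open>z i\<close> vanish, which leaves
    \<open>x_i = t i\<close> and \<open>y_i = - t i\<close>, the substitution of
    \<open>spec_hom e N\<close>.\<close>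
  have eval: "unital_hom (\<lambda>p :: ((nat \<Rightarrow>\<^sub>0 nat) \<Rightarrow>\<^sub>0 'k) poly. poly p 0)"
    by (simp add: unital_hom_def)
  have "poly (\<Phi> f) 0 - spec_hom e N f \<in> {0}" for f
  proof (rule homs_congruent[OF unital_hom_comp[OF eval hom] unital_hom_spec_hom])
    show "ideal_set {0 :: (nat \<Rightarrow>\<^sub>0 nat) \<Rightarrow>\<^sub>0 'k}"
      by (simp add: ideal_set_def)
    have t0: "poly (t i) 0 = (if i \<in> N then 0 else Var (e i))" and z0: "poly (z i) 0 = 0" for i
      by (auto simp: t_def z_def)
    fix v :: "'v + 'v"
    show "poly (\<Phi> (Var v)) 0 - spec_hom e N (Var v) \<in> {0}"
      by (cases v) (simp_all add: vals(1,2)[unfolded var_x_eq var_y_eq] t0 z0 del: One_nat_def)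
  qed (simp add: vals)
  then have "poly (\<Phi> f) 0 = spec_hom e N f" for f
    by simp
  moreover have "N \<inter> T = {}"
    using N_disj by blast
  ultimately show ?thesis
    using that[of \<Phi> N] hom zero w u by blast
qed

section \<open>Minimal primes and transversals\<close>

lemma parity_subset_p_plus:
  "parity_binomial_edge_ideal G \<subseteq> (p_plus :: ('v, 'k::field) xy_poly set)"
proof (rule parity_least[OF ideal_set_p_plus])
  fix i j :: 'v
  have "w i * var_x j - var_y i * w j \<in> (p_plus :: ('v, 'k) xy_poly set)"
    by (simp add: ideal_setD[OF ideal_set_p_plus] w_in_p_plus)
  then show "var_x i * var_x j - var_y i * var_y j \<in> (p_plus :: ('v, 'k) xy_poly set)"
    by (simp add: algebra_simps)
qed

text \<open>If \<open>j\<close> has no odd walk, a minimal prime inside the kernel of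
  \<open>\<Phi>\<close> avoids \<open>w j\<close> and all \<open>u i\<close> with \<open>i\<close>
  in \<open>T\<close>. Conversely, a minimal prime other than \<open>p_plus\<close> misses some
  \<open>w j\<close> but contains \<open>w j * prod u T\<close>, hence some
  \<open>u i\<close>.\<close>

lemma transversal_Delta_iff_odd_dominating:
  fixes G :: "'v::finite set set"
  assumes char: "CHAR('k::field) \<noteq> 2" and simple: "simple_graph G"
  shows "transversal T (Delta TYPE('k) G) \<longleftrightarrow> odd_dominating G T"
proof
  let ?I = "parity_binomial_edge_ideal G :: ('v, 'k) xy_poly set"
  assume trans: "transversal T (Delta TYPE('k) G)"
  show "odd_dominating G T"
  proof (rule ccontr)
    assume "\<not> ?thesis"
    then obtain j where j: "((j, True), (j, False)) \<notin> (signed_step G (insert j T))\<^sup>*"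
      by (auto simp: odd_dominating_def)
    \<comment> \<open>Only the nonvanishing of \<open>\<Phi>\<close> at \<open>w j\<close> and the
      \<open>u i\<close> matters here, and it survives merging all variables into one.\<close>
    define e :: "'v \<Rightarrow> nat" where "e = (\<lambda>_. 0)"
    obtain \<Phi> :: "('v, 'k) xy_poly \<Rightarrow> ((nat \<Rightarrow>\<^sub>0 nat) \<Rightarrow>\<^sub>0 'k) poly" and N
      where \<Phi>: "unital_hom \<Phi>" "\<forall>f\<in>?I. \<Phi> f = 0" "\<Phi> (w j) \<noteq> 0"
        "\<forall>i\<in>T. \<Phi> (u i) \<noteq> 0" "N \<inter> T = {}" "\<forall>f. poly (\<Phi> f) 0 = spec_hom e N f"
      by (rule separating_hom[OF char j])
    obtain Q where Q: "Q \<in> minimal_primes xy_ring ?I" "Q \<subseteq> {f. \<Phi> f = 0}"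
      using minimal_prime_below_prime[OF primeideal_kernel[OF \<Phi>(1)], of ?I] \<Phi>(2) by auto
    have "Q \<noteq> p_plus"
      using Q(2) \<Phi>(3) w_in_p_plus[of j] by auto
    then have "T \<inter> minus_set Q \<noteq> {}"
      using trans Q(1) by (auto simp: transversal_def Delta_def)
    then show False
      using Q(2) \<Phi>(4) by (auto simp: minus_set_def)
  qed
next
  let ?I = "parity_binomial_edge_ideal G :: ('v, 'k) xy_poly set"
  assume odd: "odd_dominating G T"
  have "T \<inter> minus_set Q \<noteq> {}" if Q: "Q \<in> minimal_primes xy_ring ?I" "Q \<noteq> p_plus" for Q
  proof -
    have prime: "primeideal Q xy_ring" and I: "?I \<subseteq> Q"
      using Q(1) by (auto simp: minimal_primes_def)
    from prime have ideal: "ideal_set Q"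
      and mult: "\<And>a b. a * b \<in> Q \<Longrightarrow> a \<in> Q \<or> b \<in> Q"
      by (auto simp: primeideal_ring_of_type_algebra_iff)
    have "\<not> p_plus \<subseteq> Q"
    proof
      assume "p_plus \<subseteq> Q"
      then have "p_plus = Q"
        using Q(1) primeideal_p_plus parity_subset_p_plus[of G] by (auto simp: minimal_primes_def)
      with Q(2) show False by simp
    qed
    then obtain j where j: "w j \<notin> Q"
      using p_plus_least[OF ideal] by blast
    have "w j * prod u T \<in> Q"
      using w_times_prod_u_in_parity[OF char simple odd] I by blast
    then have "prod u T \<in> Q"
      using mult j by blast
    then show ?thesis
      using primeideal_prodD[OF prime] by (auto simp: minus_set_def)
  qed
  then show "transversal T (Delta TYPE('k) G)"
    by (auto simp: transversal_def Delta_def)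
qed

section \<open>Elements whose colon ideal is \<open>p_plus\<close>\<close>

lemma prod_u_notin_p_plus:
  assumes "CHAR('k::field) \<noteq> 2"
  shows "prod u T \<notin> (p_plus :: ('v::finite, 'k) xy_poly set)"
proof
  assume prod: "prod u T \<in> (p_plus :: ('v, 'k) xy_poly set)"
  obtain e :: "'v \<Rightarrow> nat" where e: "inj e"
    using exists_numbering by blast
  obtain i where "u i \<in> (p_plus :: ('v, 'k) xy_poly set)"
    using primeideal_prodD[OF primeideal_p_plus prod] by blast
  then have "spec_hom e {} (u i) = (0 :: (nat \<Rightarrow>\<^sub>0 nat) \<Rightarrow>\<^sub>0 'k)"
    using p_plus_eq_kernel[OF e] by auto
  \<comment> \<open>Modulo \<open>p_plus\<close>, \<open>u i\<close> is twice a variable.\<close>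
  then have "Var (e i) + Var (e i) = (0 :: (nat \<Rightarrow>\<^sub>0 nat) \<Rightarrow>\<^sub>0 'k)"
    by (simp add: unital_homD[OF unital_hom_spec_hom] var_x_eq var_y_eq del: One_nat_def)
  then have "Poly_Mapping.lookup (Var (e i) + Var (e i) :: (nat \<Rightarrow>\<^sub>0 nat) \<Rightarrow>\<^sub>0 'k)
      (Poly_Mapping.single (e i) 1) = 0"
    by (simp only: lookup_zero)
  then show False
    using two_neq_zero[OF assms] by (simp only: lookup_add lookup_single_eq) simp
qed

text \<open>One inclusion is the annihilation along odd walks. The other holds because the prime
  \<open>p_plus\<close> contains the edge ideal but not the product. This bounds the v-number from
  above.\<close>

lemma colon_prod_u:
  fixes G :: "'v::finite set set"
  assumes "CHAR('k::field) \<noteq> 2" "simple_graph G" "odd_dominating G T"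
  shows "colon_ideal xy_ring (parity_binomial_edge_ideal G) (prod u T)
    = (p_plus :: ('v, 'k) xy_poly set)" (is "colon_ideal _ ?I ?f = _")
proof
  have "g \<in> p_plus" if "g * ?f \<in> ?I" for g :: "('v, 'k) xy_poly"
    using that parity_subset_p_plus[of G] prod_u_notin_p_plus[OF assms(1), of T]
      primeideal_p_plus[where ?'v = 'v and ?'k = 'k]
    unfolding primeideal_ring_of_type_algebra_iff by blast
  then show "colon_ideal xy_ring ?I ?f \<subseteq> p_plus"
    by (auto simp: colon_ideal_def)
  have "ideal_set {g. g * ?f \<in> ?I}"
    using ideal_setD[OF ideal_set_parity[of G]]
    by (auto simp: ideal_set_def distrib_right mult.assoc)
  then have "p_plus \<subseteq> {g. g * ?f \<in> ?I}"
    by (rule p_plus_least) (use w_times_prod_u_in_parity[OF assms] in blast)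
  then show "p_plus \<subseteq> colon_ideal xy_ring ?I ?f"
    by (simp add: colon_ideal_def)
qed

lemma prod_u_graded: "prod u T \<in> (graded_piece (card T) :: ('v::finite, 'k::field) xy_poly set)"
proof -
  have "prod u T \<in> homog (\<Sum>i\<in>T. 1)"
    by (rule homog_prod) (simp add: homog_diff homog_Var var_x_eq var_y_eq del: One_nat_def)
  then show ?thesis
    by (simp add: graded_piece_eq_homog)
qed

text \<open>The support of any monomial of \<open>f\<close> modulo \<open>p_plus\<close> is a transversal: otherwise the family
  of points from \<open>separating_hom\<close> forces that monomial to have coefficient \<open>0\<close>.\<close>

lemma transversal_from_colon:
  fixes G :: "'v::finite set set"
  assumes char: "CHAR('k::field) \<noteq> 2" and simple: "simple_graph G"
    and univ: "odd_dominating G UNIV"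
    and f: "f \<in> graded_piece d" "colon_ideal xy_ring (parity_binomial_edge_ideal G) f
      = (p_plus :: ('v, 'k) xy_poly set)"
  shows "\<exists>T. odd_dominating G T \<and> card T \<le> d"
proof -
  let ?I = "parity_binomial_edge_ideal G :: ('v, 'k) xy_poly set"
  have colon: "g * f \<in> ?I \<longleftrightarrow> g \<in> p_plus" for g
    using f(2) by (auto simp: colon_ideal_def)
  \<comment> \<open>Otherwise \<open>prod u UNIV\<close>, which \<open>p_plus\<close> annihilates
    modulo the edge ideal, would lie in the colon ideal of \<open>f\<close>, that is in
    \<open>p_plus\<close>.\<close>
  have "f \<notin> p_plus"
  proof
    assume "f \<in> p_plus"
    then have "prod u UNIV * f \<in> ?I"
      using colon_prod_u[OF char simple univ] by (auto simp: colon_ideal_def mult.commute)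
    then show False
      using colon prod_u_notin_p_plus[OF char] by blast
  qed
  obtain e :: "'v \<Rightarrow> nat" where e: "inj e"
    using exists_numbering by blast
  have "spec_hom e {} f \<noteq> 0"
    using \<open>f \<notin> p_plus\<close> p_plus_eq_kernel[OF e] by blast
  then obtain a where a: "a \<in> Poly_Mapping.keys (spec_hom e {} f)"
    by (metis all_not_in_conv keys_eq_empty)
  define T where "T = {i. e i \<in> Poly_Mapping.keys a}"
  have "spec_hom e {} f \<in> homog d"
    unfolding spec_hom_def
  proof (rule homog_subst_linear)
    show "f \<in> homog d"
      using f(1) by (simp add: graded_piece_eq_homog)
    fix v :: "'v + 'v"
    show "case_sum (\<lambda>i. if i \<in> {} then 0 else Var (e i))
      (\<lambda>i. if i \<in> {} then 0 else - Var (e i)) v \<in> homog 1"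
      by (cases v) (simp_all add: homog_Var homog_uminus del: One_nat_def)
  qed
  then have "mdeg a = d"
    using a by (simp add: homog_def)
  \<comment> \<open>Each variable in the support of \<open>a\<close> contributes at least
    \<open>1\<close> to the degree.\<close>
  have "card T = card (e ` T)"
    using e by (simp add: card_image inj_on_subset)
  also have "\<dots> = (\<Sum>n\<in>e ` T. 1)"
    by simp
  also have "\<dots> \<le> (\<Sum>n\<in>e ` T. Poly_Mapping.lookup a n)"
    by (intro sum_mono) (auto simp: T_def in_keys_iff)
  also have "\<dots> \<le> mdeg a"
    unfolding mdeg_def by (intro sum_mono2) (auto simp: T_def)
  finally have "card T \<le> d"
    using \<open>mdeg a = d\<close> by simp
  moreover have "odd_dominating G T"
  proof (rule ccontr)
    assume "\<not> ?thesis"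
    then obtain j where j: "((j, True), (j, False)) \<notin> (signed_step G (insert j T))\<^sup>*"
      by (auto simp: odd_dominating_def)
    obtain \<Phi> :: "('v, 'k) xy_poly \<Rightarrow> ((nat \<Rightarrow>\<^sub>0 nat) \<Rightarrow>\<^sub>0 'k) poly" and N
      where \<Phi>: "unital_hom \<Phi>" "\<forall>f\<in>?I. \<Phi> f = 0" "\<Phi> (w j) \<noteq> 0"
        "\<forall>i\<in>T. \<Phi> (u i) \<noteq> 0" "N \<inter> T = {}" "\<forall>f. poly (\<Phi> f) 0 = spec_hom e N f"
      by (rule separating_hom[OF char j])
    \<comment> \<open>The target of \<open>\<Phi>\<close> is a domain, so
      \<open>\<Phi> f = 0\<close>. Specializing the parameter to \<open>0\<close> kills only
      variables outside \<open>a\<close>, so the coefficient of \<open>a\<close> would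
      vanish.\<close>
    have "w j * f \<in> ?I"
      by (simp only: colon w_in_p_plus)
    then have "\<Phi> (w j * f) = 0"
      by (rule bspec[OF \<Phi>(2)])
    then have "\<Phi> (w j) * \<Phi> f = 0"
      by (simp only: unital_homD(3)[OF \<Phi>(1)])
    then have "\<Phi> f = 0"
      using \<Phi>(3) by (simp only: mult_eq_0_iff) blast
    then have "spec_hom e N f = 0"
      using spec[OF \<Phi>(6), of f] by simp
    moreover have "Poly_Mapping.keys a \<inter> e ` N = {}"
      using \<Phi>(5) by (auto simp: T_def)
    ultimately have "Poly_Mapping.lookup (spec_hom e {} f) a = 0"
      using lookup_spec_hom[of a e N f] by simp
    with a show False
      by (simp add: in_keys_iff)
  qed
  ultimately show ?thesis
    by blast
qed

theorem theorem6p15: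
  fixes G :: "'v::finite set set"
  assumes "CHAR('k::alg_closed_field) \<noteq> 2"
    and "simple_graph G"
    and "connected_graph G"
    and "\<not> bipartite_graph G"
  shows "local_v_number (p_plus :: ('v, 'k) xy_poly set) (parity_binomial_edge_ideal G)
           = transversal_number (Delta TYPE('k) G)"
proof -
  let ?P = "\<lambda>d. \<exists>f \<in> graded_piece d. colon_ideal xy_ring (parity_binomial_edge_ideal G) f
    = (p_plus :: ('v, 'k) xy_poly set)"
  let ?Q = "\<lambda>k. \<exists>T. odd_dominating G T \<and> card T = k"
  have univ: "odd_dominating G UNIV"
    using assms(3,4) by (rule odd_dominating_UNIV)
  have Q_imp_P: "?P k" if "?Q k" for k
    using that colon_prod_u[OF assms(1,2)] prod_u_graded by blast
  \<comment> \<open>The support of a monomial can be smaller than its degree, so only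
    \<open>k \<le> d\<close> is available; this suffices for the minima.\<close>
  have P_imp_Q: "\<exists>k\<le>d. ?Q k" if "?P d" for d
    using that transversal_from_colon[OF assms(1,2) univ] by blast
  have "(LEAST d. ?P d) = (LEAST k. ?Q k)"
  proof (rule Least_equality)
    have "?Q (card (UNIV :: 'v set))"
      using univ by blast
    then have "?Q (LEAST k. ?Q k)"
      by (rule LeastI)
    then show "?P (LEAST k. ?Q k)"
      by (rule Q_imp_P)
    fix d assume "?P d"
    then obtain k where k: "k \<le> d" "?Q k"
      using P_imp_Q by blast
    from Least_le[of ?Q, OF k(2)] k(1) show "(LEAST k. ?Q k) \<le> d"
      by (rule order_trans)
  qed
  then show ?thesis
    by (simp only: local_v_number_def transversal_number_def
        transversal_Delta_iff_odd_dominating[OF assms(1,2)])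
qed

end
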